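(* For all integers $n,k\ge 1$, $$\frac{1}{(n+k)!}\sum_{w\in\mathfrak{S}_{n+k}}B_w(x)\,E_{\ell_w}(x)=\frac{1}{n!\,k!}\sum_{\pi\in\mathfrak{S}_n,\ \sigma\in\mathfrak{S}_k}B_\pi(x)\,B_\sigma(x)\,E_{\ell_\pi+\ell_\sigma}(x).$$ In other words, $$\sum_{w\in\mathfrak{S}_{n+k}}B_w(x)\,E_{\ell_w}(x)=\binom{n+k}{n}\sum_{\pi\in\mathfrak{S}_n,\ \sigma\in\mathfrak{S}_k}B_\pi(x)\,B_\sigma(x)\,E_{\ell_\pi+\ell_\sigma}(x).$$
   Context: $\mathfrak{S}_n$ is the symmetric group on $\{1,\ldots,n\}$. The Eulerian polynomial is $E_n(x)=\sum_{w\in\mathfrak{S}_n}x^{\operatorname{des}(w)}$, where $\operatorname{des}(w)=|\{i: w_i>w_{i+1}\}|$. The type B Narayana polynomial is $B_n(x)=\sum_{k=0}^{n-1}\binom{n-1}{k}^2x^k$. For a permutation $w$ with cycle type $(\lambda_1,\ldots,\lambda_\ell)$ (fixed points counted as cycles), $\ell_w=\ell$ is the number of cycles of $w$ and $B_w(x)=B_{\lambda_1}(x)\cdots B_{\lambda_\ell}(x)$. *)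

theory Defs
  imports
    "HOL-Combinatorics.Orbits"
    "HOL-Computational_Algebra.Polynomial"
    "HOL-Library.Multiset"
begin

definition des :: "nat \<Rightarrow> (nat \<Rightarrow> nat) \<Rightarrow> nat" where
  "des n w = card {i \<in> {1..<n}. w i > w (i + 1)}"

definition eulerian_poly :: "nat \<Rightarrow> rat poly" where
  "eulerian_poly n = (\<Sum>w | w permutes {1..n}. monom 1 (des n w))"

definition narayana_B_poly :: "nat \<Rightarrow> rat poly" where
  "narayana_B_poly n = (\<Sum>k<n. monom (of_nat ((n - 1 choose k) ^ 2)) k)"

text \<open>
  The cycles of a permutation of \<open>{1..n}\<close> correspond to its orbits on \<open>{1..n}\<close>; fixed points
  give singleton orbits. The \<open>n\<close> has to be passed explicitly because a function permuting
  \<open>{1..n}\<close> does not determine \<open>n\<close>.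
\<close>

definition cycle_type :: "nat \<Rightarrow> (nat \<Rightarrow> nat) \<Rightarrow> nat multiset" where
  "cycle_type n w = image_mset card (mset_set (orbit w ` {1..n}))"

definition num_cycles :: "nat \<Rightarrow> (nat \<Rightarrow> nat) \<Rightarrow> nat" where
  "num_cycles n w = size (cycle_type n w)"

definition narayana_B_perm :: "nat \<Rightarrow> (nat \<Rightarrow> nat) \<Rightarrow> rat poly" where
  "narayana_B_perm n w = (\<Prod>l\<in>#cycle_type n w. narayana_B_poly l)"

end

theory Submission
  imports Defs "HOL-Computational_Algebra.Polynomial_FPS"
begin

text \<open>
  Fix a rational \<open>x \<noteq> 1\<close>, put \<open>d = 1 - x\<close>, and let \<open>h\<^sub>n(y) = 1/n! \<Sum>\<^sub>w B\<^sub>w(x) y\<^bsup>l(w)\<^esup>\<close>, where \<open>l(w)\<close> is the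
  number of cycles. If \<open>L\<close> is the linear functional \<open>y\<^sup>i \<mapsto> E\<^sub>i(x)\<close>, the claim at \<open>x\<close> reads
  \<open>L(h\<^sub>n h\<^sub>k) = L(h\<^bsub>n+k\<^esub>)\<close>, so it suffices to show \<open>L(h\<^sub>n h\<^bsub>k+1\<^esub>) = L(h\<^bsub>n+1\<^esub> h\<^sub>k)\<close>.

  The identity \<open>E\<^sub>n(x) = (1-x)\<^bsup>n+1\<^esup> \<Sum>\<^sub>m (m+1)\<^sup>n x\<^sup>m\<close> turns into \<open>L(p(y)) - x L(p(y+d)) = d p(d)\<close>.
  The exponential formula gives \<open>G\<^sub>y(t) = \<Sum>\<^sub>n h\<^sub>n(y) t\<^sup>n = exp(y \<integral> P)\<close> with \<open>P = \<Sum>\<^sub>n B\<^bsub>n+1\<^esub>(x) t\<^sup>n\<close>, and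
  \<open>P\<^sup>-\<^sup>2 = 1 - 2(1+x)t + d\<^sup>2t\<^sup>2\<close> by the Legendre recurrence for \<open>B\<^sub>n\<close>. Integrating,
  \<open>2x G\<^sub>d = A - d/P\<close> and \<open>2 G\<^bsub>-d\<^esub> = A + d/P\<close> for \<open>A = 1 + x - d\<^sup>2t\<close>, so \<open>x G\<^sub>d + G\<^bsub>-d\<^esub> = A\<close>. Multiplying
  by \<open>G\<^sub>y\<close> yields a three-term relation between \<open>h\<^sub>n(y+d)\<close>, \<open>h\<^sub>n(y)\<close>, \<open>h\<^sub>n(y-d)\<close> and \<open>h\<^bsub>n-1\<^esub>(y)\<close>, by which
  \<open>L(h\<^sub>n h\<^bsub>k+1\<^esub> - h\<^bsub>n+1\<^esub> h\<^sub>k)\<close> telescopes to zero.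
\<close>

subsection \<open>Narayana polynomials of type B\<close>

text \<open>The difference \<open>Z\<close> solves the same equation, which expresses
  \<open>(m+1) Z_{m+1}\<close> through \<open>Z_0, ..., Z_m\<close>, so every coefficient vanishes.
  Closed forms for exponentials of power series are verified this way.\<close>

lemma fps_linear_ode_unique:
  fixes V W P :: "'a::field_char_0 fps"
  assumes "fps_deriv V = fps_const c * P * V" "fps_deriv W = fps_const c * P * W"
    and "fps_nth V 0 = fps_nth W 0"
  shows "V = W"
proof -
  define Z where "Z = V - W"
  have Z: "fps_deriv Z = fps_const c * P * Z"
    using assms by (simp add: Z_def algebra_simps)
  have "fps_nth Z n = 0" for n
  proof (induction n rule: less_induct)
    case (less n)
    show ?case
    proof (cases n)
      case 0
      then show ?thesis using assms(3) by (simp add: Z_def)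
    next
      case (Suc m)
      have "of_nat (Suc m) * fps_nth Z (Suc m) = fps_nth (fps_const c * P * Z) m"
        unfolding Z[symmetric] by simp
      also have "\<dots> = 0"
        unfolding fps_mult_nth[of "fps_const c * P"] using less Suc by (intro sum.neutral) auto
      finally show ?thesis using Suc by (simp del: of_nat_Suc)
    qed
  qed
  then show ?thesis by (simp add: Z_def fps_eq_iff)
qed


lemma coeff_narayana_B_poly: "coeff (narayana_B_poly (Suc n)) j = of_nat ((n choose j)\<^sup>2)"
proof -
  have "coeff (narayana_B_poly (Suc n)) j = (\<Sum>k<Suc n. if k = j then of_nat ((n choose k)\<^sup>2) else 0)"
    by (simp add: narayana_B_poly_def coeff_sum)
  then show ?thesis
    by (auto simp add: sum.delta simp del: of_nat_power)
qed

text \<open>Two instances of the absorption identity \<open>k C(n+1,k) = (n+1) C(n,k-1)\<close> with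
  consecutive \<open>k\<close>, cross-multiplied and subtracted, eliminate \<open>j\<close>.\<close>

lemma binomial_log_concavity_defect:
  "of_nat (Suc n) * ((of_nat (n choose Suc j))\<^sup>2 - of_nat (n choose Suc (Suc j)) * of_nat (n choose j))
   = (of_nat (Suc n choose Suc (Suc j)) * of_nat (Suc n choose Suc j) :: 'a::field_char_0)"
proof -
  define N a b c :: 'a where "N = of_nat (Suc n)" and "a = of_nat (n choose Suc (Suc j))"
    and "b = of_nat (n choose Suc j)" and "c = of_nat (n choose j)"
  have N: "N \<noteq> 0" by (simp add: N_def del: of_nat_Suc)
  have "(of_nat j + 2) * (a + b) = N * b"
    using arg_cong[OF Suc_times_binomial[of "Suc j" n], of "of_nat :: nat \<Rightarrow> 'a"]
    by (simp add: N_def a_def b_def algebra_simps)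
  moreover have "(of_nat j + 1) * (b + c) = N * c"
    using arg_cong[OF Suc_times_binomial[of j n], of "of_nat :: nat \<Rightarrow> 'a"]
    by (simp add: N_def b_def c_def algebra_simps)
  ultimately have "N * (N * (b\<^sup>2 - a * c)) = N * ((a + b) * (b + c))"
    by algebra
  then have "N * (b\<^sup>2 - a * c) = (a + b) * (b + c)"
    using N by simp
  then show ?thesis by (simp add: N_def a_def b_def c_def algebra_simps)
qed

text \<open>This is the Legendre recurrence in disguise:
  \<open>B_{n+1}(x) = (1-x)^n Leg_n((1+x)/(1-x))\<close> for the Legendre polynomial
  \<open>Leg_n\<close>.\<close>

lemma narayana_B_poly_recurrence:
  "smult (of_nat (Suc (Suc n))) (narayana_B_poly (Suc (Suc (Suc n))))
   = smult (of_nat (2 * n + 3)) ([:1, 1:] * narayana_B_poly (Suc (Suc n)))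
     - smult (of_nat (Suc n)) ([:1, -2, 1:] * narayana_B_poly (Suc n))"
  (is "?l = ?r")
proof (rule poly_eqI)
  fix i
  consider "i = 0" | "i = 1" | j where "i = Suc (Suc j)"
    by (metis One_nat_def not0_implies_Suc)
  then show "coeff ?l i = coeff ?r i"
  proof cases
    case 3
    define N a b c :: rat where "N = of_nat (Suc n)" and "a = of_nat (n choose Suc (Suc j))"
      and "b = of_nat (n choose Suc j)" and "c = of_nat (n choose j)"
    have "N * (b\<^sup>2 - a * c) = (a + b) * (b + c)"
      using binomial_log_concavity_defect[of n j, where 'a = rat]
      by (simp add: N_def a_def b_def c_def algebra_simps)
    \<comment> \<open>By Pascal's rule the binomials of rows \<open>n + 1\<close> and
      \<open>n + 2\<close> are \<open>a + b\<close>, \<open>b + c\<close> and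
      \<open>a + 2 * b + c\<close>.\<close>
    then have "(N + 1) * (a + 2 * b + c)\<^sup>2 = (2 * N + 1) * ((a + b)\<^sup>2 + (b + c)\<^sup>2) - N * (a\<^sup>2 - 2 * b\<^sup>2 + c\<^sup>2)"
      by algebra
    then show ?thesis using 3
      by (simp add: coeff_narayana_B_poly N_def a_def b_def c_def algebra_simps)
  qed (simp_all add: coeff_narayana_B_poly algebra_simps power2_eq_square)
qed

subsection \<open>Sums over cycle types\<close>

lemma orbit_eq_if_mem:
  assumes "permutation f" "y \<in> orbit f x"
  shows "orbit f y = orbit f x"
  using cyclic_on_orbit'[OF assms(1), of x] assms(2) unfolding cyclic_on_alldef by blast

text \<open>As \<open>q\<close> fixes \<open>a\<close>, the transposition sends the
  \<open>q\<close>-predecessor of \<open>b\<close> to \<open>a\<close> and \<open>a\<close> to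
  \<open>b\<close>: it splices \<open>a\<close> into the cycle of \<open>b\<close> and leaves the
  other cycles alone.\<close>

lemma orbit_transpose_comp:
  assumes q: "q permutes S" and S: "finite S" and a: "a \<notin> S" and b: "b \<in> S"
  defines "w \<equiv> transpose a b \<circ> q"
  shows "orbit w b = insert a (orbit q b)"
    and "b \<notin> orbit q y \<Longrightarrow> a \<noteq> y \<Longrightarrow> orbit w y = orbit q y"
proof -
  have permq: "permutation q" using q S permutation_permutes by blast
  have permw: "permutation w"
    unfolding w_def by (intro permutation_compose permutation_swap_id permq)
  have qa: "q a = a" using q a by (simp add: permutes_not_in)
  have sub: "orbit q b \<subseteq> S" using q b by (rule permutes_orbit_subset)
  have ab: "a \<noteq> b" using a b by blast
  have wa: "w a = b" by (simp add: w_def qa)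
  have bq: "b \<in> orbit q b" using permq by (rule permutation_self_in_orbit)
  have bw: "b \<in> orbit w b" using permw by (rule permutation_self_in_orbit)
  have aw: "a \<in> orbit w b"
    using permutation_self_in_orbit[OF permw, of a] permutation_orbit_step[OF permw, of a] wa by simp
  have w_step: "w x = (if q x = b then a else q x)" if "x \<in> orbit q b" for x
  proof -
    have "q x \<noteq> a" using orbit.step[OF that] sub a by blast
    then show ?thesis by (simp add: w_def transpose_def)
  qed
  show "orbit w b = insert a (orbit q b)"
  proof (intro subset_antisym subsetI)
    fix x assume "x \<in> orbit w b"
    then show "x \<in> insert a (orbit q b)"
    proof induction
      case base
      then show ?case using w_step[OF bq] by (auto intro: orbit.base)
    next
      case (step x)
      then show ?case
        using wa w_step[of x] bq orbit.step[of x q b] by (cases "x = a"; cases "q x = b") auto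
    qed
  next
    fix x assume "x \<in> insert a (orbit q b)"
    then consider "x = a" | "x \<in> orbit q b" by blast
    then show "x \<in> orbit w b"
    proof cases
      case 2
      then show ?thesis
      proof induction
        case base
        then show ?case using w_step[OF bq] bw by (metis orbit.base)
      next
        case (step x)
        then show ?case using w_step[of x] bw by (metis orbit.step)
      qed
    qed (use aw in simp)
  qed
  assume nb: "b \<notin> orbit q y" and ay: "a \<noteq> y"
  have "a \<notin> orbit q y"
  proof
    assume "a \<in> orbit q y"
    then have "y \<in> orbit q a"
      using orbit_eq_if_mem[OF permq] permutation_self_in_orbit[OF permq] by metis
    moreover have "orbit q a = {a}" using qa by (simp add: orbit_eq_singleton_iff)
    ultimately show False using ay by simp
  qed
  then have "w x = q x" if "x \<in> orbit q y" for x
    using orbit.step[OF that] nb by (auto simp: w_def transpose_def)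
  then show "orbit w y = orbit q y"
    by (intro orbit_cong permutation_self_in_orbit permq)
qed

lemma cycle_type_fix:
  assumes "q permutes {1..n}"
  shows "cycle_type (Suc n) q = add_mset 1 (cycle_type n q)"
proof -
  have o: "orbit q (Suc n) = {Suc n}"
    using assms by (simp add: orbit_eq_singleton_iff permutes_not_in)
  have new: "{Suc n} \<notin> orbit q ` {1..n}"
  proof
    assume "{Suc n} \<in> orbit q ` {1..n}"
    then obtain y where "y \<in> {1..n}" "orbit q y = {Suc n}" by (metis imageE)
    then show False using permutes_orbit_subset[OF assms, of y] by simp
  qed
  have ins: "{1..Suc n} = insert (Suc n) {1..n}" by auto
  have "orbit q ` {1..Suc n} = insert {Suc n} (orbit q ` {1..n})"
    by (simp only: ins image_insert o)
  then show ?thesis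
    using new by (simp add: cycle_type_def)
qed

lemma cycle_type_transpose_comp:
  assumes q: "q permutes {1..n}" and b: "b \<in> {1..n}"
  shows "cycle_type (Suc n) (transpose (Suc n) b \<circ> q)
         = add_mset (Suc (card (orbit q b))) (cycle_type n q - {#card (orbit q b)#})"
proof -
  define w where "w = transpose (Suc n) b \<circ> q"
  have permq: "permutation q" using q permutation_permutes by blast
  have permw: "permutation w"
    unfolding w_def by (intro permutation_compose permutation_swap_id permq)
  have ob: "orbit w b = insert (Suc n) (orbit q b)"
    using orbit_transpose_comp(1)[OF q _ _ b, of "Suc n"] by (simp add: w_def)
  have sub: "orbit q y \<subseteq> {1..n}" if "y \<in> {1..n}" for y
    using permutes_orbit_subset[OF q that] .
  have oy: "orbit w y = (if orbit q y = orbit q b then orbit w b else orbit q y)" if y: "y \<in> {1..n}" for y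
  proof (cases "orbit q y = orbit q b")
    case True
    then have "y \<in> orbit w b"
      using ob permutation_self_in_orbit[OF permq, of y] by simp
    then show ?thesis using True orbit_eq_if_mem[OF permw] by simp
  next
    case False
    then have "b \<notin> orbit q y" using orbit_eq_if_mem[OF permq] by metis
    then show ?thesis
      using False orbit_transpose_comp(2)[OF q _ _ b, of "Suc n" y] y by (simp add: w_def)
  qed
  have oS: "orbit w (Suc n) = orbit w b"
    using ob orbit_eq_if_mem[OF permw, of "Suc n" b] by simp
  have ins: "{1..Suc n} = insert (Suc n) {1..n}" by auto
  have "orbit w ` {1..Suc n} = insert (orbit w b) (orbit w ` {1..n})"
    by (simp only: ins image_insert oS)
  also have "\<dots> = insert (orbit w b) (orbit q ` {1..n} - {orbit q b})"
  proof -
    have "orbit w ` {1..n} = (\<lambda>y. if orbit q y = orbit q b then orbit w b else orbit q y) ` {1..n}"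
      using oy by (rule image_cong[OF refl])
    then show ?thesis using b by auto
  qed
  finally have im: "orbit w ` {1..Suc n} = insert (orbit w b) (orbit q ` {1..n} - {orbit q b})" .
  \<comment> \<open>Orbits form a set, so the enlarged orbit must be seen to be new: it alone
    contains \<open>Suc n\<close>.\<close>
  have new: "orbit w b \<notin> orbit q ` {1..n} - {orbit q b}"
  proof
    assume "orbit w b \<in> orbit q ` {1..n} - {orbit q b}"
    then obtain y where "y \<in> {1..n}" "orbit q y = orbit w b" by (metis DiffD1 imageE)
    then show False using sub[of y] ob by simp
  qed
  have "card (orbit w b) = Suc (card (orbit q b))"
    unfolding ob using sub[OF b] finite_subset[OF sub[OF b]] by (intro card_insert_disjoint) auto
  then have "cycle_type (Suc n) w = add_mset (Suc (card (orbit q b)))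
      (image_mset card (mset_set (orbit q ` {1..n} - {orbit q b})))"
    unfolding cycle_type_def im using new by simp
  also have "mset_set (orbit q ` {1..n} - {orbit q b}) = mset_set (orbit q ` {1..n}) - {#orbit q b#}"
    using b by (subst mset_set_Diff) auto
  also have "image_mset card \<dots> = cycle_type n q - {#card (orbit q b)#}"
    unfolding cycle_type_def using b by (subst image_mset_Diff) auto
  finally show ?thesis by (simp only: w_def)
qed

text \<open>Grouping the points by their cycle counts a cycle of length \<open>l\<close> once for
  each of its \<open>l\<close> points.\<close>

lemma sum_card_orbit:
  assumes q: "q permutes {1..n}"
  shows "(\<Sum>b\<in>{1..n}. g (card (orbit q b))) = (\<Sum>l\<in>#cycle_type n q. of_nat l * (g l :: 'a::comm_semiring_1))"
proof -
  have permq: "permutation q" using q permutation_permutes by blast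
  have fib: "{b \<in> {1..n}. orbit q b = C} = C" if "C \<in> orbit q ` {1..n}" for C
    using that permutes_orbit_subset[OF q] orbit_eq_if_mem[OF permq] permutation_self_in_orbit[OF permq]
    by blast
  have "(\<Sum>b\<in>{1..n}. g (card (orbit q b)))
        = (\<Sum>C\<in>orbit q ` {1..n}. \<Sum>b\<in>{b \<in> {1..n}. orbit q b = C}. g (card (orbit q b)))"
    by (rule sum.image_gen) simp
  also have "\<dots> = (\<Sum>C\<in>orbit q ` {1..n}. of_nat (card C) * g (card C))"
  proof (rule sum.cong[OF refl])
    fix C assume C: "C \<in> orbit q ` {1..n}"
    have "(\<Sum>b\<in>{b \<in> {1..n}. orbit q b = C}. g (card (orbit q b)))
          = (\<Sum>b\<in>{b \<in> {1..n}. orbit q b = C}. g (card C))"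
      by (rule sum.cong) auto
    then show "(\<Sum>b\<in>{b \<in> {1..n}. orbit q b = C}. g (card (orbit q b))) = of_nat (card C) * g (card C)"
      by (simp only: fib[OF C] sum_constant)
  qed
  also have "\<dots> = (\<Sum>l\<in>#cycle_type n q. of_nat l * g l)"
    by (simp add: cycle_type_def sum_unfold_sum_mset image_mset.compositionality o_def)
  finally show ?thesis .
qed

section \<open>Averages over the symmetric group and the exponential formula\<close>

text \<open>The summand is an arbitrary function of the cycle type, so that inductions can absorb a
  distinguished cycle into it.\<close>

definition cycle_type_sum :: "nat \<Rightarrow> (nat multiset \<Rightarrow> 'a) \<Rightarrow> 'a::field_char_0" where
  "cycle_type_sum n f = (\<Sum>w | w permutes {1..n}. f (cycle_type n w)) / fact n"

lemma cycle_type_sum_0: "cycle_type_sum 0 f = f {#}"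
  by (simp add: cycle_type_sum_def cycle_type_def)

lemma cycle_type_sum_add:
  "cycle_type_sum n (\<lambda>M. f M + g M) = cycle_type_sum n f + cycle_type_sum n g"
  by (simp add: cycle_type_sum_def sum.distrib add_divide_distrib)

lemma cycle_type_sum_mult:
  "cycle_type_sum n (\<lambda>M. c * f M) = c * cycle_type_sum n f"
  by (simp add: cycle_type_sum_def sum_distrib_left)

text \<open>
  A permutation of \<open>{1..n+1}\<close> arises from one of \<open>{1..n}\<close> by making \<open>n + 1\<close> a fixed point or by
  inserting it into a cycle; a cycle of length \<open>l\<close> offers \<open>l\<close> places.
\<close>

lemma cycle_type_sum_Suc:
  "of_nat (Suc n) * cycle_type_sum (Suc n) f = cycle_type_sum n
     (\<lambda>M. f (add_mset 1 M) + (\<Sum>l\<in>#M. of_nat l * f (add_mset (Suc l) (M - {#l#}))))"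
proof -
  have ins: "{1..Suc n} = insert (Suc n) {1..n}" by auto
  have "(\<Sum>w | w permutes {1..Suc n}. f (cycle_type (Suc n) w))
        = (\<Sum>b\<in>insert (Suc n) {1..n}. \<Sum>q | q permutes {1..n}. f (cycle_type (Suc n) (transpose (Suc n) b \<circ> q)))"
    unfolding ins by (rule sum_over_permutations_insert) auto
  also have "\<dots> = (\<Sum>q | q permutes {1..n}. \<Sum>b\<in>insert (Suc n) {1..n}. f (cycle_type (Suc n) (transpose (Suc n) b \<circ> q)))"
    by (rule sum.swap)
  also have "\<dots> = (\<Sum>q | q permutes {1..n}. f (add_mset 1 (cycle_type n q)) +
      (\<Sum>l\<in>#cycle_type n q. of_nat l * f (add_mset (Suc l) (cycle_type n q - {#l#}))))"
  proof (rule sum.cong[OF refl])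
    fix q assume "q \<in> {q. q permutes {1..n}}"
    then have q: "q permutes {1..n}" by simp
    have "(\<Sum>b\<in>{1..n}. f (cycle_type (Suc n) (transpose (Suc n) b \<circ> q)))
       = (\<Sum>l\<in>#cycle_type n q. of_nat l * f (add_mset (Suc l) (cycle_type n q - {#l#})))"
      unfolding sum_card_orbit[OF q, symmetric, of "\<lambda>l. f (add_mset (Suc l) (cycle_type n q - {#l#}))"]
      by (rule sum.cong) (simp_all add: cycle_type_transpose_comp[OF q])
    moreover have "(\<Sum>b\<in>insert (Suc n) {1..n}. f (cycle_type (Suc n) (transpose (Suc n) b \<circ> q)))
       = f (cycle_type (Suc n) (transpose (Suc n) (Suc n) \<circ> q))
         + (\<Sum>b\<in>{1..n}. f (cycle_type (Suc n) (transpose (Suc n) b \<circ> q)))"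
      by (rule sum.insert) simp_all
    ultimately show "(\<Sum>b\<in>insert (Suc n) {1..n}. f (cycle_type (Suc n) (transpose (Suc n) b \<circ> q)))
       = f (add_mset 1 (cycle_type n q)) + (\<Sum>l\<in>#cycle_type n q. of_nat l * f (add_mset (Suc l) (cycle_type n q - {#l#})))"
      by (simp only: transpose_same id_comp cycle_type_fix[OF q])
  qed
  finally show ?thesis
    unfolding cycle_type_sum_def fact_Suc times_divide_eq_right
    by (simp only: mult_divide_mult_cancel_left of_nat_eq_0_iff nat.distinct not_False_eq_True)
qed

text \<open>
  This is the exponential formula, with the generic summand \<open>f\<close> in place of a monomial in
  infinitely many variables.
\<close>

lemma cycle_type_sum_recurrence:
  "of_nat (Suc n) * cycle_type_sum (Suc n) f = (\<Sum>j\<le>n. cycle_type_sum (n - j) (\<lambda>M. f (add_mset (Suc j) M)))"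
proof (induction n arbitrary: f)
  case 0
  then show ?case by (subst cycle_type_sum_Suc) (simp add: cycle_type_sum_0)
next
  case (Suc n)
  define T where "T = (\<lambda>i. cycle_type_sum (Suc n - i) (\<lambda>M. f (add_mset (Suc i) M)))"
  define g where "g = (\<lambda>M. f (add_mset 1 M) + (\<Sum>l\<in>#M. of_nat l * f (add_mset (Suc l) (M - {#l#}))))"
  \<comment> \<open>Either the new point is a fixed point or joins a cycle of \<open>M\<close>,
    which sums up to the multiple of \<open>T j\<close>, or it lengthens the distinguished cycle,
    which gives the multiple of \<open>T (Suc j)\<close>.\<close>
  have step: "cycle_type_sum (n - j) (\<lambda>M. g (add_mset (Suc j) M))
      = of_nat (Suc n - j) * T j + of_nat (Suc j) * T (Suc j)" if "j \<le> n" for j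
  proof -
    have g: "g (add_mset (Suc j) M) =
       (f (add_mset (Suc j) (add_mset 1 M)) +
         (\<Sum>l\<in>#M. of_nat l * f (add_mset (Suc j) (add_mset (Suc l) (M - {#l#})))))
       + of_nat (Suc j) * f (add_mset (Suc (Suc j)) M)" for M
    proof -
      have "image_mset (\<lambda>l. of_nat l * f (add_mset (Suc l) (add_mset (Suc j) M - {#l#}))) M
          = image_mset (\<lambda>l. of_nat l * f (add_mset (Suc j) (add_mset (Suc l) (M - {#l#})))) M"
      proof (rule image_mset_cong)
        fix l assume "l \<in># M"
        then obtain N where N: "M = add_mset l N" by (metis multi_member_split)
        have "add_mset (Suc l) (add_mset (Suc j) M - {#l#}) = add_mset (Suc j) (add_mset (Suc l) (M - {#l#}))"
          unfolding N add_mset_commute[of "Suc j" l] add_mset_remove_trivial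
          by (rule add_mset_commute)
        then show "of_nat l * f (add_mset (Suc l) (add_mset (Suc j) M - {#l#}))
          = of_nat l * f (add_mset (Suc j) (add_mset (Suc l) (M - {#l#})))" by (simp only:)
      qed
      then show ?thesis
        by (simp add: g_def add_mset_commute[of 1] add_mset_commute[of "Suc 0"] add.assoc add.commute add.left_commute
              del: of_nat_Suc)
    qed
    have "cycle_type_sum (n - j) (\<lambda>M. g (add_mset (Suc j) M))
       = of_nat (Suc (n - j)) * cycle_type_sum (Suc (n - j)) (\<lambda>M. f (add_mset (Suc j) M))
         + of_nat (Suc j) * cycle_type_sum (n - j) (\<lambda>M. f (add_mset (Suc (Suc j)) M))"
      unfolding g cycle_type_sum_add[of _ _ "\<lambda>M. of_nat (Suc j) * f (add_mset (Suc (Suc j)) M)"]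
        cycle_type_sum_mult cycle_type_sum_Suc ..
    then show ?thesis using that by (simp add: T_def Suc_diff_le)
  qed
  have "of_nat (Suc n) * (of_nat (Suc (Suc n)) * cycle_type_sum (Suc (Suc n)) f)
      = of_nat (Suc n) * cycle_type_sum (Suc n) g"
    unfolding g_def cycle_type_sum_Suc[of "Suc n" f] ..
  also have "\<dots> = (\<Sum>j\<le>n. of_nat (Suc n - j) * T j + of_nat (Suc j) * T (Suc j))"
    unfolding Suc.IH using step by (intro sum.cong) auto
  \<comment> \<open>The terms added at \<open>j = Suc n\<close> on the left and, after the index
    shift, at \<open>j = 0\<close> on the right carry weight 0; the weights then add up to
    \<open>Suc n\<close>.\<close>
  also have "\<dots> = (\<Sum>j\<le>Suc n. of_nat (Suc n - j) * T j) + (\<Sum>j\<le>Suc n. of_nat j * T j)"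
    by (simp add: sum.distrib sum.atMost_Suc_shift[of "\<lambda>j. of_nat j * T j"] del: sum.atMost_Suc of_nat_Suc)
       (simp del: of_nat_Suc)
  also have "\<dots> = (\<Sum>j\<le>Suc n. of_nat (Suc n) * T j)"
    unfolding sum.distrib[symmetric] distrib_right[symmetric] of_nat_add[symmetric]
    by (intro sum.cong) auto
  finally have "of_nat (Suc n) * (of_nat (Suc (Suc n)) * cycle_type_sum (Suc (Suc n)) f)
      = of_nat (Suc n) * (\<Sum>j\<le>Suc n. T j)"
    by (simp only: sum_distrib_left)
  then show ?case
    unfolding T_def by (simp only: mult_cancel_left of_nat_eq_0_iff nat.distinct simp_thms)
qed

subsection \<open>Eulerian polynomials\<close>

text \<open>Composing with this permutation inserts the value \<open>n + 1\<close> at position \<open>p\<close>.\<close>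

definition move_to_end :: "nat \<Rightarrow> nat \<Rightarrow> nat \<Rightarrow> nat" where
  "move_to_end n p i = (if i < p \<or> Suc n < i then i else if i = p then Suc n else i - 1)"

lemma move_to_end_permutes:
  assumes "p \<in> {1..Suc n}"
  shows "move_to_end n p permutes {1..Suc n}"
proof (rule inj_imp_permutes)
  show "inj_on (move_to_end n p) {1..Suc n}"
    using assms by (auto simp: inj_on_def move_to_end_def split: if_splits)
qed (use assms in \<open>auto simp: move_to_end_def\<close>)

text \<open>The witness for \<open>w\<close> takes \<open>p\<close> as the position of the value
  \<open>n + 1\<close>; undoing the move gives a permutation fixing \<open>n + 1\<close>, hence one
  of \<open>{1..n}\<close>.\<close>

lemma sum_permutes_Suc:
  "(\<Sum>w | w permutes {1..Suc n}. g w)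
   = (\<Sum>v | v permutes {1..n}. \<Sum>p\<in>{1..Suc n}. g (v \<circ> move_to_end n p))"
proof -
  let ?c = "move_to_end n"
  have c: "?c p p = Suc n" if "p \<in> {1..Suc n}" for p
    using that by (auto simp: move_to_end_def)
  have max_pos: "inv w (Suc n) \<in> {1..Suc n}" if "w permutes {1..Suc n}" for w
    using permutes_in_image[OF permutes_inv[OF that], of "Suc n"] by simp
  have comp_c: "v \<circ> ?c p permutes {1..Suc n}" if "v permutes {1..n}" "p \<in> {1..Suc n}" for v p
    by (intro permutes_compose move_to_end_permutes that(2) permutes_subset[OF that(1)]) auto
  have inv_c: "w \<circ> inv (?c p) \<circ> ?c p = w" if "p \<in> {1..Suc n}" for w p
    by (simp only: comp_assoc permutes_inv_o(2)[OF move_to_end_permutes[OF that]] comp_id)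
  have c_inv: "v \<circ> ?c p \<circ> inv (?c p) = v" if "p \<in> {1..Suc n}" for v p
    by (simp only: comp_assoc permutes_inv_o(1)[OF move_to_end_permutes[OF that]] comp_id)
  have "(\<Sum>w | w permutes {1..Suc n}. g w)
     = (\<Sum>(v, p)\<in>{v. v permutes {1..n}} \<times> {1..Suc n}. g (v \<circ> ?c p))"
  proof (rule sum.reindex_bij_witness[where i = "\<lambda>(v, p). v \<circ> ?c p"
        and j = "\<lambda>w. (w \<circ> inv (?c (inv w (Suc n))), inv w (Suc n))"], goal_cases)
    case (1 w)
    then show ?case using inv_c[OF max_pos, of w w] by (simp only: mem_Collect_eq prod.case)
  next
    case (2 w)
    then have w: "w permutes {1..Suc n}" by (simp only: mem_Collect_eq)
    define p where "p = inv w (Suc n)"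
    have p: "p \<in> {1..Suc n}" unfolding p_def by (rule max_pos[OF w])
    have "inv (?c p) (Suc n) = p"
      using c[OF p] permutes_inverses(2)[OF move_to_end_permutes[OF p], of p] by (simp only:)
    then have fix_max: "(w \<circ> inv (?c p)) (Suc n) = Suc n"
      using permutes_inverses(1)[OF w] by (simp only: comp_apply p_def)
    have "w \<circ> inv (?c p) permutes {1..n}"
    proof (rule permutes_superset)
      show "w \<circ> inv (?c p) permutes {1..Suc n}"
        by (intro permutes_compose permutes_inv move_to_end_permutes p w)
      show "(w \<circ> inv (?c p)) x = x" if "x \<in> {1..Suc n} - {1..n}" for x
        using that fix_max by (cases "x = Suc n") (auto simp del: comp_apply)
    qed
    then show ?case using p by (simp only: p_def mem_Sigma_iff mem_Collect_eq simp_thms)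
  next
    case (3 vp)
    then obtain v p where vp: "vp = (v, p)" and v: "v permutes {1..n}" and p: "p \<in> {1..Suc n}"
      by (cases vp) simp
    have "(v \<circ> ?c p) p = Suc n"
      using c[OF p] v by (simp add: permutes_not_in)
    then have "inv (v \<circ> ?c p) (Suc n) = p"
      using permutes_inverses(2)[OF comp_c[OF v p], of p] by (simp only:)
    then show ?case
      by (simp only: vp prod.case c_inv[OF p])
  next
    case (4 vp)
    then show ?case using comp_c by (cases vp) (simp only: prod.case mem_Sigma_iff mem_Collect_eq)
  next
    case (5 w)
    then show ?case using inv_c[OF max_pos, of w w] by (simp only: mem_Collect_eq prod.case)
  qed
  then show ?thesis by (simp only: sum.cartesian_product)
qed

section \<open>Descents under insertion of the maximum\<close>

definition descents :: "nat \<Rightarrow> (nat \<Rightarrow> nat) \<Rightarrow> nat set" where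
  "descents n w = {i \<in> {1..<n}. w i > w (Suc i)}"

lemma des_eq_card_descents: "des n w = card (descents n w)"
  by (simp add: des_def descents_def)

lemma finite_descents: "finite (descents n w)"
  by (simp add: descents_def)

lemma des_le: "des n w \<le> n - 1"
proof -
  have "descents n w \<subseteq> {1..<n}" by (auto simp: descents_def)
  from card_mono[OF _ this] show ?thesis by (simp add: des_eq_card_descents)
qed

text \<open>A maximum not placed last creates a descent at \<open>p\<close> and separates positions
  \<open>p - 1\<close> and \<open>p\<close> of \<open>v\<close>; the count is unchanged exactly when
  this destroys a descent or the maximum comes last.\<close>

lemma des_insert_max:
  assumes v: "v permutes {1..n}" and p: "p \<in> {1..Suc n}"
  shows "des (Suc n) (v \<circ> move_to_end n p)
    = (if p \<in> insert (Suc n) (Suc ` descents n v) then des n v else Suc (des n v))"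
proof (cases "p = Suc n")
  case True
  have le: "v i \<le> n" if "i \<in> {1..n}" for i
    using permutes_in_image[OF v] that by (metis atLeastAtMost_iff)
  have vS: "v (Suc n) = Suc n" using v by (simp add: permutes_not_in)
  have "i \<in> descents (Suc n) (v \<circ> move_to_end n p) \<longleftrightarrow> i \<in> descents n v" for i
  proof -
    consider "i = 0 \<or> n < i" | "i < n" | "i = n" "1 \<le> n" by linarith
    then show ?thesis
      using le[of n] vS True by cases (auto simp: descents_def move_to_end_def)
  qed
  then have "descents (Suc n) (v \<circ> move_to_end n p) = descents n v" by blast
  then show ?thesis using True by (simp add: des_eq_card_descents)
next
  case False
  with p have p: "1 \<le> p" "p \<le> n" by auto
  have le: "v i \<le> n" if "i \<in> {1..n}" for i
    using permutes_in_image[OF v] that by (metis atLeastAtMost_iff)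
  have vS: "v (Suc n) = Suc n" using v by (simp add: permutes_not_in)
  let ?w = "v \<circ> move_to_end n p"
  \<comment> \<open>Position \<open>p - 1\<close> is in neither set: it now precedes the maximum.
    Descents in \<open>?B\<close> move one place to the right.\<close>
  let ?A = "{i \<in> descents n v. Suc i < p}" and ?B = "{i \<in> descents n v. p \<le> i}"
  have w: "?w i = (if i < p then v i else if i = p then Suc n else v (i - 1))" if "i \<in> {1..Suc n}" for i
    using that vS p by (auto simp: move_to_end_def)
  have "i \<in> descents (Suc n) ?w \<longleftrightarrow> i \<in> ?A \<union> insert p (Suc ` ?B)" for i
  proof -
    consider "i = 0 \<or> n < i" | "1 \<le> i" "Suc i < p" | "1 \<le> i" "Suc i = p" | "i = p" | "p < i" "i \<le> n"
      using p by linarith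
    then show ?thesis
    proof cases
      case 1
      then show ?thesis using p by (auto simp: descents_def)
    next
      case 2
      then show ?thesis using p w[of i] w[of "Suc i"] by (auto simp: descents_def)
    next
      case 3
      then show ?thesis using p w[of i] w[of "Suc i"] le[of i] by (auto simp: descents_def)
    next
      case 4
      then show ?thesis using p w[of i] w[of "Suc i"] le[of i] by (auto simp: descents_def)
    next
      case 5
      then obtain j where "i = Suc j" by (metis Suc_pred' gr0I not_less0)
      then show ?thesis using 5 p w[of i] w[of "Suc i"] by (auto simp: descents_def)
    qed
  qed
  then have "descents (Suc n) ?w = ?A \<union> insert p (Suc ` ?B)" by blast
  moreover have "card (insert p (Suc ` ?B)) = Suc (card ?B)"
    by (subst card_insert_disjoint) (auto simp: finite_descents card_image)
  then have "card (?A \<union> insert p (Suc ` ?B)) = card ?A + Suc (card ?B)"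
    by (subst card_Un_disjoint) (auto simp: finite_descents)
  ultimately have des: "des (Suc n) ?w = card (?A \<union> ?B) + 1"
    by (subst card_Un_disjoint) (auto simp: des_eq_card_descents finite_descents)
  have "?A \<union> ?B = descents n v - {p - 1}"
    using p by auto
  then have "des (Suc n) ?w = card (descents n v - {p - 1}) + 1" using des by simp
  moreover have "p \<in> insert (Suc n) (Suc ` descents n v) \<longleftrightarrow> p - 1 \<in> descents n v"
    using p by (auto simp: image_iff intro!: bexI[of _ "p - 1"])
  ultimately show ?thesis
    using finite_descents[of n v] card_Suc_Diff1[of "descents n v" "p - 1"]
    by (simp add: des_eq_card_descents)
qed

lemma eulerian_poly_0: "eulerian_poly 0 = 1"
  by (simp add: eulerian_poly_def des_def)

text \<open>A permutation with \<open>d\<close> descents has \<open>d + 1\<close> extensions with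
  \<open>d\<close> descents and \<open>n - d\<close> with \<open>d + 1\<close>; and
  \<open>(d+1) x^d + (n-d) x^{d+1}\<close> equals
  \<open>(1 + n x) x^d + (x - x^2) d x^{d-1}\<close>.\<close>

lemma eulerian_poly_Suc:
  "eulerian_poly (Suc n) = [:1, of_nat n:] * eulerian_poly n + [:0, 1, -1:] * pderiv (eulerian_poly n)"
proof -
  have *: "(\<Sum>p\<in>{1..Suc n}. monom (1::rat) (des (Suc n) (v \<circ> move_to_end n p)))
      = [:1, of_nat n:] * monom 1 (des n v) + [:0, 1, -1:] * pderiv (monom 1 (des n v))"
    if v: "v permutes {1..n}" for v
  proof -
    let ?I = "insert (Suc n) (Suc ` descents n v)" and ?d = "des n v"
    have I: "?I \<subseteq> {1..Suc n}" by (auto simp: descents_def)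
    have "card ?I = Suc ?d"
      by (subst card_insert_disjoint)
        (auto simp: finite_descents card_image des_eq_card_descents, auto simp: descents_def)
    moreover from this have "card ({1..Suc n} - ?I) = n - ?d"
      using I by (subst card_Diff_subset) (auto simp: finite_descents)
    moreover have "(\<Sum>p\<in>{1..Suc n}. monom (1::rat) (des (Suc n) (v \<circ> move_to_end n p)))
        = (\<Sum>p\<in>{1..Suc n}. if p \<in> ?I then monom 1 ?d else monom 1 (Suc ?d))"
      by (rule sum.cong) (simp_all add: des_insert_max[OF v])
    moreover have "\<dots> = (\<Sum>p\<in>{1..Suc n} - ?I. monom 1 (Suc ?d)) + (\<Sum>p\<in>?I. monom 1 ?d)"
      by (subst sum.subset_diff[OF I]) simp_all
    ultimately have "(\<Sum>p\<in>{1..Suc n}. monom (1::rat) (des (Suc n) (v \<circ> move_to_end n p)))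
        = of_nat (n - ?d) * monom 1 (Suc ?d) + of_nat (Suc ?d) * monom 1 ?d"
      by (simp del: of_nat_Suc)
    also have "\<dots> = [:1, of_nat n:] * monom 1 ?d + [:0, 1, -1:] * pderiv (monom 1 ?d)"
      using des_le[of n v]
      by (cases ?d)
        (auto simp: pderiv_monom of_nat_diff of_nat_poly poly_eq_iff coeff_pCons algebra_simps
          split: nat.splits)
    finally show ?thesis .
  qed
  have "eulerian_poly (Suc n) = (\<Sum>v | v permutes {1..n}.
      [:1, of_nat n:] * monom 1 (des n v) + [:0, 1, -1:] * pderiv (monom 1 (des n v)))"
    unfolding eulerian_poly_def sum_permutes_Suc by (rule sum.cong[OF refl]) (simp only: mem_Collect_eq *)
  then show ?thesis
    using higher_pderiv_sum[of 1 "\<lambda>v. monom (1::rat) (des n v)" "{v. v permutes {1..n}}"]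
    by (simp only: eulerian_poly_def sum.distrib sum_distrib_left funpow.simps One_nat_def comp_id)
qed

text \<open>The operator \<open>1 + X d/dX\<close> multiplies coefficient \<open>m\<close> by
  \<open>m + 1\<close>; conjugated by the powers of \<open>1 - X\<close>, it becomes the recurrence
  for Eulerian polynomials.\<close>

lemma fps_of_poly_eulerian_poly:
  "fps_of_poly (eulerian_poly n) = (1 - fps_X) ^ Suc n * Abs_fps (\<lambda>m. of_nat (Suc m) ^ n)"
proof (induction n)
  case 0
  have "(1 - fps_X) * Abs_fps (\<lambda>m. 1) = (1 :: rat fps)"
  proof (rule fps_ext)
    fix m show "fps_nth ((1 - fps_X) * Abs_fps (\<lambda>m. 1)) m = fps_nth (1 :: rat fps) m"
      by (cases m) (simp_all add: left_diff_distrib)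
  qed
  then show ?case by (simp add: eulerian_poly_0)
next
  case (Suc n)
  define S :: "nat \<Rightarrow> rat fps" where "S = (\<lambda>n. Abs_fps (\<lambda>m. of_nat (Suc m) ^ n))"
  have S: "S (Suc n) = S n + fps_X * fps_deriv (S n)"
  proof (rule fps_ext)
    fix m show "fps_nth (S (Suc n)) m = fps_nth (S n + fps_X * fps_deriv (S n)) m"
      by (cases m) (simp_all add: S_def algebra_simps)
  qed
  have "fps_of_poly (eulerian_poly (Suc n))
      = (1 + of_nat n * fps_X) * ((1 - fps_X) ^ Suc n * S n)
        + fps_X * (1 - fps_X) * fps_deriv ((1 - fps_X) ^ Suc n * S n)"
    unfolding eulerian_poly_Suc fps_of_poly_add fps_of_poly_mult fps_of_poly_pderiv Suc.IH S_def
    by (simp add: fps_of_poly_pCons fps_of_nat algebra_simps flip: fps_const_neg)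
  also have "fps_deriv ((1 - fps_X) ^ Suc n * S n)
      = (1 - fps_X) ^ Suc n * fps_deriv (S n) - of_nat (Suc n) * (1 - fps_X) ^ n * S n"
    by (simp add: fps_deriv_power' algebra_simps del: power_Suc of_nat_Suc)
  also have "(1 + of_nat n * fps_X) * ((1 - fps_X) ^ Suc n * S n) + fps_X * (1 - fps_X) * \<dots>
      = (1 - fps_X) ^ Suc (Suc n) * S (Suc n)"
    unfolding S power_Suc of_nat_Suc by algebra
  finally show ?case by (simp add: S_def)
qed


text \<open>Split the term \<open>m = 0\<close> off \<open>\<Sum> (m+1)^n X^m\<close>, expand the
  other coefficients \<open>((m-1+1)+1)^n\<close> binomially, and multiply by
  \<open>(1 - X)^{n+1}\<close>.\<close>

lemma eulerian_poly_binomial: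
  "eulerian_poly n = [:0, 1:] * (\<Sum>j\<le>n. smult (of_nat (n choose j)) ([:1, -1:] ^ (n - j) * eulerian_poly j))
     + [:1, -1:] ^ Suc n"
proof -
  define S :: "nat \<Rightarrow> rat fps" where "S = (\<lambda>n. Abs_fps (\<lambda>m. of_nat (Suc m) ^ n))"
  have E: "fps_of_poly (eulerian_poly j) = (1 - fps_X) ^ Suc j * S j" for j
    by (simp only: fps_of_poly_eulerian_poly S_def)
  have X: "fps_of_poly [:1, -1:] = (1 - fps_X :: rat fps)"
    by (simp add: fps_of_poly_pCons flip: fps_const_neg)
  have S: "S n = fps_X * (\<Sum>j\<le>n. fps_const (of_nat (n choose j)) * S j) + 1"
  proof (rule fps_ext)
    fix m
    show "fps_nth (S n) m = fps_nth (fps_X * (\<Sum>j\<le>n. fps_const (of_nat (n choose j)) * S j) + 1) m"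
    proof (cases m)
      case 0
      then show ?thesis by (simp add: S_def)
    next
      case (Suc k)
      have "(of_nat (Suc k) + 1 :: rat) ^ n = (\<Sum>j\<le>n. of_nat (n choose j) * of_nat (Suc k) ^ j)"
        by (subst binomial_ring) simp
      then show ?thesis by (simp add: Suc S_def fps_sum_nth add.commute)
    qed
  qed
  have "fps_of_poly ([:0, 1:] * (\<Sum>j\<le>n. smult (of_nat (n choose j)) ([:1, -1:] ^ (n - j) * eulerian_poly j)) + [:1, -1:] ^ Suc n)
      = fps_X * (\<Sum>j\<le>n. fps_const (of_nat (n choose j)) * ((1 - fps_X) ^ (n - j) * ((1 - fps_X) ^ Suc j * S j)))
        + (1 - fps_X) ^ Suc n"
    by (simp only: fps_of_poly_add fps_of_poly_mult fps_of_poly_sum fps_of_poly_smult fps_of_poly_power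
        fps_of_poly_fps_X X E)
  also have "(\<Sum>j\<le>n. fps_const (of_nat (n choose j)) * ((1 - fps_X) ^ (n - j) * ((1 - fps_X) ^ Suc j * S j)))
      = (1 - fps_X) ^ Suc n * (\<Sum>j\<le>n. fps_const (of_nat (n choose j)) * S j)"
    unfolding sum_distrib_left
  proof (rule sum.cong[OF refl])
    fix j assume "j \<in> {..n}"
    then have "(1 - fps_X) ^ Suc n = (1 - fps_X) ^ (n - j) * (1 - fps_X :: rat fps) ^ Suc j"
      by (simp flip: power_add add: Suc_diff_le del: power_Suc)
    then show "fps_const (of_nat (n choose j)) * ((1 - fps_X) ^ (n - j) * ((1 - fps_X) ^ Suc j * S j))
       = (1 - fps_X) ^ Suc n * (fps_const (of_nat (n choose j)) * S j)"
      by (simp only: mult_ac)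
  qed
  also have "fps_X * \<dots> + (1 - fps_X) ^ Suc n = fps_of_poly (eulerian_poly n)"
    unfolding E by (subst S) (simp only: distrib_left mult_1_right mult_1_left mult_ac)
  finally show ?thesis by (simp only: fps_of_poly_eq_iff)
qed

subsection \<open>The Eulerian functional\<close>

definition eulerian_functional :: "rat \<Rightarrow> rat poly \<Rightarrow> rat" where
  "eulerian_functional x p = (\<Sum>i\<le>degree p. coeff p i * poly (eulerian_poly i) x)"

text \<open>A common bound on the degrees is what makes additivity a termwise statement.\<close>

lemma eulerian_functional_altdef:
  assumes "degree p \<le> N"
  shows "eulerian_functional x p = (\<Sum>i\<le>N. coeff p i * poly (eulerian_poly i) x)"
  unfolding eulerian_functional_def
  using assms by (intro sum.mono_neutral_left) (auto simp: coeff_eq_0)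

lemma eulerian_functional_0: "eulerian_functional x 0 = 0"
  by (simp add: eulerian_functional_def)

lemma eulerian_functional_add:
  "eulerian_functional x (p + q) = eulerian_functional x p + eulerian_functional x q"
proof -
  define N where "N = max (degree p) (degree q)"
  have "degree (p + q) \<le> N" "degree p \<le> N" "degree q \<le> N"
    by (simp_all add: N_def degree_add_le_max)
  then show ?thesis
    by (simp add: eulerian_functional_altdef[of _ N] sum.distrib distrib_right)
qed

lemma eulerian_functional_smult:
  "eulerian_functional x (smult c p) = c * eulerian_functional x p"
  by (simp add: eulerian_functional_altdef[of _ "degree p"] sum_distrib_left mult.assoc)

lemma eulerian_functional_diff:
  "eulerian_functional x (p - q) = eulerian_functional x p - eulerian_functional x q"
  using eulerian_functional_add[of x "p - q" q] by simp

lemma eulerian_functional_sum: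
  "eulerian_functional x (\<Sum>a\<in>A. f a) = (\<Sum>a\<in>A. eulerian_functional x (f a))"
  by (induction A rule: infinite_finite_induct)
    (simp_all add: eulerian_functional_0 eulerian_functional_add)

lemma eulerian_functional_monom:
  "eulerian_functional x (monom c n) = c * poly (eulerian_poly n) x"
proof -
  have "eulerian_functional x (monom c n) = (\<Sum>i\<le>n. if n = i then c * poly (eulerian_poly i) x else 0)"
    unfolding eulerian_functional_altdef[OF degree_monom_le] by (rule sum.cong) auto
  then show ?thesis by simp
qed

text \<open>Formally \<open>L(p) = d \<Sum> x^m p(d (m+1))\<close> with \<open>d = 1 - x\<close>,
  and shifting drops the term \<open>m = 0\<close>. The rigorous form on monomials is
  \<open>eulerian_poly_binomial\<close> at \<open>x\<close>; linearity does the rest.\<close>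

lemma eulerian_functional_shift:
  "eulerian_functional x p - x * eulerian_functional x (p \<circ>\<^sub>p [:1 - x, 1:]) = (1 - x) * poly p (1 - x)"
proof -
  define d where "d = 1 - x"
  have monom: "eulerian_functional x (monom c n) - x * eulerian_functional x (monom c n \<circ>\<^sub>p [:d, 1:])
      = d * poly (monom c n) d" for c n
  proof -
    have "poly (eulerian_poly n) x = x * (\<Sum>j\<le>n. of_nat (n choose j) * (d ^ (n - j) * poly (eulerian_poly j) x)) + d ^ Suc n"
      by (subst eulerian_poly_binomial) (simp add: poly_sum d_def left_diff_distrib)
    moreover have "monom c n \<circ>\<^sub>p [:d, 1:] = (\<Sum>j\<le>n. monom (c * of_nat (n choose j) * d ^ (n - j)) j)"
    proof (rule poly_eq_poly_eq_iff[THEN iffD1], rule ext)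
      fix y
      show "poly (monom c n \<circ>\<^sub>p [:d, 1:]) y = poly (\<Sum>j\<le>n. monom (c * of_nat (n choose j) * d ^ (n - j)) j) y"
        using binomial_ring[of y d n]
        by (simp add: poly_pcompose poly_monom poly_sum sum_distrib_left add.commute mult_ac)
    qed
    ultimately show ?thesis
      by (simp add: eulerian_functional_sum eulerian_functional_monom poly_monom sum_distrib_left algebra_simps)
  qed
  have "eulerian_functional x p - x * eulerian_functional x (p \<circ>\<^sub>p [:d, 1:])
     = (\<Sum>i\<le>degree p. eulerian_functional x (monom (coeff p i) i)
          - x * eulerian_functional x (monom (coeff p i) i \<circ>\<^sub>p [:d, 1:]))"
    by (subst (1 2) poly_as_sum_of_monoms[symmetric])
      (simp only: pcompose_sum eulerian_functional_sum sum_subtractf sum_distrib_left)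
  also have "\<dots> = d * (\<Sum>i\<le>degree p. poly (monom (coeff p i) i) d)"
    by (simp only: monom sum_distrib_left)
  also have "(\<Sum>i\<le>degree p. poly (monom (coeff p i) i) d) = poly p d"
    by (subst poly_as_sum_of_monoms[of p, symmetric]) (simp only: poly_sum)
  finally show ?thesis by (simp only: d_def)
qed

subsection \<open>The cycle index polynomials\<close>

text \<open>This is \<open>h_n\<close>: the cycle index of the symmetric group with its
  \<open>l\<close>-th variable set to \<open>y B_l(x)\<close>, as a polynomial in
  \<open>y\<close>.\<close>

definition cycle_index_poly :: "rat \<Rightarrow> nat \<Rightarrow> rat poly" where
  "cycle_index_poly x n = smult (1 / fact n)
     (\<Sum>w | w permutes {1..n}. monom (poly (narayana_B_perm n w) x) (num_cycles n w))"

text \<open>Giving each cycle one factor \<open>y\<close> makes the summand multiplicative over the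
  cycle type, so the recurrence for \<open>cycle_type_sum\<close> closes.\<close>

lemma poly_cycle_index_poly:
  "poly (cycle_index_poly x n) y = cycle_type_sum n (\<lambda>M. \<Prod>l\<in>#M. y * poly (narayana_B_poly l) x)"
proof -
  have "poly (prod_mset N) x = prod_mset (image_mset (\<lambda>p. poly p x) N)" for N :: "rat poly multiset"
    by (induction N) auto
  then show ?thesis
    by (simp add: cycle_index_poly_def cycle_type_sum_def poly_sum poly_monom narayana_B_perm_def num_cycles_def
        prod_mset.distrib image_mset.compositionality o_def mult.commute)
qed

lemma cycle_index_poly_0: "cycle_index_poly x 0 = 1"
  by (simp add: cycle_index_poly_def cycle_type_def narayana_B_perm_def num_cycles_def)

lemma poly_cycle_index_poly_Suc:
  "of_nat (Suc n) * poly (cycle_index_poly x (Suc n)) y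
   = (\<Sum>j\<le>n. y * poly (narayana_B_poly (Suc j)) x * poly (cycle_index_poly x (n - j)) y)"
  unfolding poly_cycle_index_poly cycle_type_sum_recurrence
  by (simp add: cycle_type_sum_mult)

section \<open>Generating functions at a fixed rational argument\<close>

context
  fixes x :: rat
begin

text \<open>The index shift makes this series, \<open>P\<close>, the derivative of
  \<open>\<Sum> B_l(x) t^l / l\<close>.\<close>

definition narayana_B_fps :: "rat fps" where
  "narayana_B_fps = Abs_fps (\<lambda>n. poly (narayana_B_poly (Suc n)) x)"

definition cycle_index_fps :: "rat \<Rightarrow> rat fps" where
  "cycle_index_fps y = Abs_fps (\<lambda>n. poly (cycle_index_poly x n) y)"

text \<open>The differential form of \<open>G_y = exp(y \<integral> P)\<close>; its coefficients are
  the recurrence for \<open>h_n\<close>.\<close>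

lemma fps_deriv_cycle_index_fps:
  "fps_deriv (cycle_index_fps y) = fps_const y * narayana_B_fps * cycle_index_fps y"
proof (rule fps_ext)
  fix n
  have "fps_nth (fps_deriv (cycle_index_fps y)) n
      = (\<Sum>j\<le>n. y * poly (narayana_B_poly (Suc j)) x * poly (cycle_index_poly x (n - j)) y)"
    unfolding poly_cycle_index_poly_Suc[symmetric] by (simp add: cycle_index_fps_def)
  then show "fps_nth (fps_deriv (cycle_index_fps y)) n
      = fps_nth (fps_const y * narayana_B_fps * cycle_index_fps y) n"
    unfolding fps_mult_nth[of "fps_const y * narayana_B_fps"]
    by (simp add: narayana_B_fps_def cycle_index_fps_def atLeast0AtMost)
qed

lemma cycle_index_fps_nth_0: "fps_nth (cycle_index_fps y) 0 = 1"
  by (simp add: cycle_index_fps_def cycle_index_poly_0)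

text \<open>Both sides solve the same linear equation and have constant term 1.\<close>

lemma cycle_index_fps_add:
  "cycle_index_fps (y + z) = cycle_index_fps y * cycle_index_fps z"
proof (rule fps_linear_ode_unique)
  show "fps_deriv (cycle_index_fps y * cycle_index_fps z)
      = fps_const (y + z) * narayana_B_fps * (cycle_index_fps y * cycle_index_fps z)"
    by (simp add: fps_deriv_cycle_index_fps algebra_simps flip: fps_const_add)
qed (simp_all add: fps_deriv_cycle_index_fps cycle_index_fps_nth_0)

text \<open>With \<open>A\<close> for \<open>trace_fps\<close> and \<open>d = 1 - x\<close>, the
  quadratic \<open>Z^2 - A Z + x\<close> has discriminant \<open>d^2\<close> times this series; its
  roots will be \<open>x G_d\<close> and \<open>G_{-d}\<close>.\<close>

definition disc_fps :: "rat fps" where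
  "disc_fps = 1 - fps_const (2 * (1 + x)) * fps_X + fps_const ((1 - x)\<^sup>2) * (fps_X * fps_X)"

definition trace_fps :: "rat fps" where
  "trace_fps = fps_const (1 + x) - fps_const ((1 - x)\<^sup>2) * fps_X"

lemma narayana_B_fps_nth_0: "fps_nth narayana_B_fps 0 = 1"
  by (simp add: narayana_B_fps_def narayana_B_poly_def poly_monom)

text \<open>Coefficient \<open>k + 1\<close> is the Legendre recurrence at \<open>k\<close>; the
  constant coefficient says \<open>b 1 = (1 + x) b 0\<close>.\<close>

lemma narayana_B_fps_ode: "disc_fps * fps_deriv narayana_B_fps = trace_fps * narayana_B_fps"
proof (rule fps_ext)
  fix m
  define b where "b = (\<lambda>n. poly (narayana_B_poly (Suc n)) x)"
  have b0: "b 0 = 1" "b (Suc 0) = 1 + x"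
    by (simp_all add: b_def narayana_B_poly_def poly_monom numeral_2_eq_2)
  have brec: "of_nat (Suc (Suc n)) * b (Suc (Suc n))
      = of_nat (2 * n + 3) * (1 + x) * b (Suc n) - of_nat (Suc n) * (1 - x)\<^sup>2 * b n" for n
    using arg_cong[OF narayana_B_poly_recurrence[of n], of "\<lambda>p. poly p x"]
    by (simp add: b_def power2_eq_square algebra_simps)
  have P: "narayana_B_fps = Abs_fps b" by (simp add: narayana_B_fps_def b_def)
  show "fps_nth (disc_fps * fps_deriv narayana_B_fps) m = fps_nth (trace_fps * narayana_B_fps) m"
  proof (cases m)
    case 0
    then show ?thesis
      by (simp add: P disc_fps_def trace_fps_def distrib_right left_diff_distrib mult.assoc b0)
  next
    case (Suc k)
    then show ?thesis using brec[of k]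
      by (cases k)
        (simp_all add: P disc_fps_def trace_fps_def distrib_right left_diff_distrib mult.assoc algebra_simps)
  qed
qed

text \<open>Since \<open>disc_fps\<close> has derivative \<open>- 2 * trace_fps\<close>, the
  equation for \<open>P\<close> makes \<open>P^2 disc_fps\<close> constant, and its constant term is
  1.\<close>

lemma inverse_narayana_B_fps_square: "inverse narayana_B_fps * inverse narayana_B_fps = disc_fps"
proof -
  let ?P = narayana_B_fps
  have disc': "fps_deriv disc_fps = - (2 * trace_fps)"
    by (simp add: disc_fps_def trace_fps_def algebra_simps flip: fps_const_mult fps_const_add)
  have "fps_deriv (?P * ?P * disc_fps) = 0"
    using narayana_B_fps_ode by (simp add: disc') algebra
  moreover have "fps_nth (?P * ?P * disc_fps) 0 = 1"
    by (simp add: narayana_B_fps_nth_0 disc_fps_def)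
  ultimately have PPQ: "?P * ?P * disc_fps = 1"
    by (simp only: fps_deriv_eq_0_iff fps_const_1_eq_1)
  have "inverse ?P * ?P = 1"
    by (simp add: inverse_mult_eq_1 narayana_B_fps_nth_0)
  with PPQ show ?thesis by algebra
qed

text \<open>With \<open>R = 1/P\<close>, both \<open>A - d R\<close> and \<open>A + d R\<close>
  solve the equations of \<open>G_d\<close> and \<open>G_{-d}\<close>, with constant terms
  \<open>1 + x - d = 2 x\<close> and \<open>1 + x + d = 2\<close>. In the sum \<open>R\<close>
  cancels.\<close>

lemma cycle_index_fps_trace:
  "fps_const x * cycle_index_fps (1 - x) + cycle_index_fps (- (1 - x)) = trace_fps"
proof -
  let ?P = narayana_B_fps and ?A = trace_fps
  define d where "d = 1 - x"
  define R where "R = inverse ?P"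
  have PR: "R * ?P = 1"
    by (simp add: R_def inverse_mult_eq_1 narayana_B_fps_nth_0)
  have A': "fps_deriv ?A = - fps_const d * fps_const d"
    by (simp add: trace_fps_def d_def power2_eq_square algebra_simps flip: fps_const_mult)
  have R0: "fps_nth R 0 = 1" by (simp add: R_def narayana_B_fps_nth_0)
  have "fps_deriv R = - fps_deriv ?P * (R * R)"
    by (simp add: R_def fps_inverse_deriv narayana_B_fps_nth_0 power2_eq_square)
  then have R': "fps_deriv R = - (?A * ?P)"
    using narayana_B_fps_ode inverse_narayana_B_fps_square by (simp add: R_def mult.commute)
  have "fps_const (2 * x) * cycle_index_fps d = ?A - fps_const d * R"
  proof (rule fps_linear_ode_unique)
    show "fps_deriv (?A - fps_const d * R) = fps_const d * ?P * (?A - fps_const d * R)"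
      using PR unfolding fps_deriv_sub fps_deriv_mult fps_deriv_const A' R' by algebra
  qed (simp_all add: fps_deriv_cycle_index_fps cycle_index_fps_nth_0 R0 trace_fps_def d_def mult_ac)
  moreover have "fps_const 2 * cycle_index_fps (- d) = ?A + fps_const d * R"
  proof (rule fps_linear_ode_unique)
    show "fps_deriv (?A + fps_const d * R) = fps_const (- d) * ?P * (?A + fps_const d * R)"
      using PR unfolding fps_deriv_add fps_deriv_mult fps_deriv_const A' R' fps_const_neg[symmetric] by algebra
  qed (simp_all add: fps_deriv_cycle_index_fps cycle_index_fps_nth_0 R0 trace_fps_def d_def mult_ac)
  ultimately have "fps_const 2 * (fps_const x * cycle_index_fps d + cycle_index_fps (- d)) = fps_const 2 * ?A"
    by (simp add: numeral_fps_const[symmetric] flip: fps_const_mult) algebra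
  then show ?thesis by (simp add: d_def)
qed

text \<open>Multiply the trace identity by \<open>G_y\<close>, use additivity in the index, and
  compare coefficients of \<open>t^{n+1}\<close>.\<close>

lemma cycle_index_poly_three_term:
  "smult x (cycle_index_poly x (Suc n) \<circ>\<^sub>p [:1 - x, 1:]) + cycle_index_poly x (Suc n) \<circ>\<^sub>p [:- (1 - x), 1:]
   = smult (1 + x) (cycle_index_poly x (Suc n)) - smult ((1 - x)\<^sup>2) (cycle_index_poly x n)"
proof (rule poly_eq_poly_eq_iff[THEN iffD1], rule ext)
  fix y
  have "fps_const x * cycle_index_fps (y + (1 - x)) + cycle_index_fps (y + - (1 - x))
      = cycle_index_fps y * trace_fps"
    unfolding cycle_index_fps_add cycle_index_fps_trace[symmetric] by algebra
  then have "fps_nth (fps_const x * cycle_index_fps (y + (1 - x)) + cycle_index_fps (y + - (1 - x))) (Suc n)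
      = fps_nth (cycle_index_fps y * trace_fps) (Suc n)"
    by (simp only:)
  then show "poly (smult x (cycle_index_poly x (Suc n) \<circ>\<^sub>p [:1 - x, 1:]) + cycle_index_poly x (Suc n) \<circ>\<^sub>p [:- (1 - x), 1:]) y
      = poly (smult (1 + x) (cycle_index_poly x (Suc n)) - smult ((1 - x)\<^sup>2) (cycle_index_poly x n)) y"
    by (simp add: cycle_index_fps_def trace_fps_def poly_pcompose right_diff_distrib mult.commute[of _ "fps_const _"]
        mult.left_commute[of _ "fps_const _"] add.commute)
qed

end

text \<open>
  With \<open>d = 1 - x\<close> and \<open>D(y) = h\<^bsub>n+1\<^esub>(y) h\<^bsub>k+1\<^esub>(y + d) - h\<^bsub>n+1\<^esub>(y + d) h\<^bsub>k+1\<^esub>(y)\<close>, the three-term relation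
  gives \<open>d\<^sup>2 (h\<^sub>n(y) h\<^bsub>k+1\<^esub>(y) - h\<^bsub>n+1\<^esub>(y) h\<^sub>k(y)) = x D(y) - D(y - d)\<close>; the functional sends
  the right-hand side to \<open>- d D(0) = 0\<close>.
\<close>

lemma eulerian_functional_cycle_index_shift:
  assumes "x \<noteq> 1"
  shows "eulerian_functional x (cycle_index_poly x n * cycle_index_poly x (Suc k))
       = eulerian_functional x (cycle_index_poly x (Suc n) * cycle_index_poly x k)"
proof -
  define d where "d = 1 - x"
  let ?h = "cycle_index_poly x"
  \<comment> \<open>Suffix 1 marks the shift by \<open>d\<close>, suffix 2 the shift by
    \<open>-d\<close>.\<close>
  define N K N1 K1 N2 K2 where "N = ?h (Suc n)" and "K = ?h (Suc k)"
    and "N1 = N \<circ>\<^sub>p [:d, 1:]" and "K1 = K \<circ>\<^sub>p [:d, 1:]"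
    and "N2 = N \<circ>\<^sub>p [:-d, 1:]" and "K2 = K \<circ>\<^sub>p [:-d, 1:]"
  define D D2 where "D = N * K1 - N1 * K" and "D2 = N2 * K - N * K2"
  have N: "smult (d\<^sup>2) (?h n) = smult (1 + x) N - smult x N1 - N2"
    using cycle_index_poly_three_term[of x n] unfolding N_def N1_def N2_def d_def
    by (simp add: algebra_simps)
  have K: "smult (d\<^sup>2) (?h k) = smult (1 + x) K - smult x K1 - K2"
    using cycle_index_poly_three_term[of x k] unfolding K_def K1_def K2_def d_def
    by (simp add: algebra_simps)
  have "smult (d\<^sup>2) (?h n) * K - N * smult (d\<^sup>2) (?h k) = smult x D - D2"
    unfolding N K D_def D2_def by (simp add: algebra_simps smult_diff_right)
  then have tele: "smult (d\<^sup>2) (?h n * K - N * ?h k) = smult x D - D2"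
    by (simp add: smult_diff_right)
  have unshift: "p \<circ>\<^sub>p [:-d, 1:] \<circ>\<^sub>p [:d, 1:] = p" for p
    unfolding pcompose_assoc[symmetric] by (simp add: pcompose_pCons)
  have h0: "poly (?h (Suc m)) 0 = 0" for m
    using poly_cycle_index_poly_Suc[of m x 0] by (simp del: of_nat_Suc)
  have "D2 \<circ>\<^sub>p [:d, 1:] = D"
    by (simp add: D_def D2_def N1_def K1_def N2_def K2_def pcompose_diff pcompose_mult unshift)
  \<comment> \<open>At \<open>d\<close> the shifted factors are evaluated at 0, where
    \<open>h_{m+1}\<close> vanishes because every term has at least one cycle.\<close>
  moreover have "poly D2 d = 0"
    by (simp add: D2_def N_def N2_def K_def K2_def poly_pcompose h0)
  ultimately have "eulerian_functional x D2 - x * eulerian_functional x D = 0"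
    using eulerian_functional_shift[of x D2] by (simp add: d_def)
  then have "d\<^sup>2 * eulerian_functional x (?h n * K - N * ?h k) = 0"
    unfolding eulerian_functional_smult[symmetric] tele
    by (simp add: eulerian_functional_diff eulerian_functional_smult)
  then show ?thesis
    using assms by (simp add: eulerian_functional_diff N_def K_def d_def)
qed

text \<open>Units move one at a time from the second index to the first until \<open>h_0 = 1\<close>
  remains.\<close>

lemma eulerian_functional_cycle_index_mult:
  assumes "x \<noteq> 1"
  shows "eulerian_functional x (cycle_index_poly x n * cycle_index_poly x k)
       = eulerian_functional x (cycle_index_poly x (n + k))"
proof (induction k arbitrary: n)
  case (Suc k)
  show ?case
    using Suc[of "Suc n"] by (simp add: eulerian_functional_cycle_index_shift[OF assms])
qed (simp add: cycle_index_poly_0)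

section \<open>Return to sums over permutations\<close>

definition eulerian_cycle_sum :: "nat \<Rightarrow> rat poly" where
  "eulerian_cycle_sum n = (\<Sum>w | w permutes {1..n}. narayana_B_perm n w * eulerian_poly (num_cycles n w))"

definition eulerian_cycle_pair_sum :: "nat \<Rightarrow> nat \<Rightarrow> rat poly" where
  "eulerian_cycle_pair_sum n k = (\<Sum>\<pi> | \<pi> permutes {1..n}. \<Sum>\<sigma> | \<sigma> permutes {1..k}.
     narayana_B_perm n \<pi> * narayana_B_perm k \<sigma> * eulerian_poly (num_cycles n \<pi> + num_cycles k \<sigma>))"

lemma eulerian_functional_cycle_index_poly:
  "eulerian_functional x (cycle_index_poly x n) = poly (eulerian_cycle_sum n) x / fact n"
  by (simp add: cycle_index_poly_def eulerian_cycle_sum_def eulerian_functional_smult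
      eulerian_functional_sum eulerian_functional_monom poly_sum)

lemma eulerian_functional_cycle_index_poly_mult:
  "eulerian_functional x (cycle_index_poly x n * cycle_index_poly x k)
   = poly (eulerian_cycle_pair_sum n k) x / (fact n * fact k)"
  by (simp add: cycle_index_poly_def eulerian_cycle_pair_sum_def eulerian_functional_smult sum_product
      eulerian_functional_sum eulerian_functional_monom poly_sum mult_monom)

text \<open>The factor \<open>1 - x\<close> covers the excluded point \<open>x = 1\<close>: the
  product vanishes at every rational, hence is zero, and the factor cancels.\<close>

lemma eulerian_cycle_sum_eq:
  "smult (1 / fact (n + k)) (eulerian_cycle_sum (n + k)) = smult (1 / (fact n * fact k)) (eulerian_cycle_pair_sum n k)"
  (is "?l = ?r")
proof -
  have "poly ([:1, -1:] * (?l - ?r)) x = 0" for x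
    using eulerian_functional_cycle_index_mult[of x n k]
    by (cases "x = 1") (simp_all add: eulerian_functional_cycle_index_poly eulerian_functional_cycle_index_poly_mult)
  then have "[:1, -1:] * (?l - ?r) = 0"
    using poly_all_0_iff_0 by blast
  then show ?thesis by (simp del: mult_pCons_left)
qed

theorem corollary5p6:
  fixes n k :: nat
  assumes "n \<ge> 1" and "k \<ge> 1"
  shows "(smult (1 / fact (n + k))
           (\<Sum>w | w permutes {1..n + k}.
              narayana_B_perm (n + k) w * eulerian_poly (num_cycles (n + k) w))
         = smult (1 / (fact n * fact k))
           (\<Sum>\<pi> | \<pi> permutes {1..n}. \<Sum>\<sigma> | \<sigma> permutes {1..k}.
              narayana_B_perm n \<pi> * narayana_B_perm k \<sigma>
                * eulerian_poly (num_cycles n \<pi> + num_cycles k \<sigma>)))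
       \<and> ((\<Sum>w | w permutes {1..n + k}.
            narayana_B_perm (n + k) w * eulerian_poly (num_cycles (n + k) w))
         = of_nat ((n + k) choose n) *
           (\<Sum>\<pi> | \<pi> permutes {1..n}. \<Sum>\<sigma> | \<sigma> permutes {1..k}.
              narayana_B_perm n \<pi> * narayana_B_perm k \<sigma>
                * eulerian_poly (num_cycles n \<pi> + num_cycles k \<sigma>)))"
proof -
  have "eulerian_cycle_sum (n + k) = smult (fact (n + k)) (smult (1 / fact (n + k)) (eulerian_cycle_sum (n + k)))"
    by simp
  also have "\<dots> = smult (of_nat ((n + k) choose n)) (eulerian_cycle_pair_sum n k)"
    unfolding eulerian_cycle_sum_eq by (simp add: binomial_fact)
  finally have "eulerian_cycle_sum (n + k) = of_nat ((n + k) choose n) * eulerian_cycle_pair_sum n k"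
    by (simp add: of_nat_poly)
  then show ?thesis
    using eulerian_cycle_sum_eq[of n k] unfolding eulerian_cycle_sum_def eulerian_cycle_pair_sum_def by blast
qed

end
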